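(* The right cylinders are the unique regular tubular surfaces in Euclidean $3$-space with second fundamental form of constant length. More precisely, for every $c>0$, the regular tubular surfaces in Euclidean $3$-space satisfying $|\mathcal{A}|\equiv c$ are exactly the right cylinders of radius $\frac1c$.
   Context: The length of the second fundamental form of a surface with Gaussian curvature $K$ and mean curvature $H$ (half the sum of the principal curvatures) is $|\mathcal{A}|=\sqrt{4H^2-2K}$. Let $\gamma:(a,b)\to\mathbb{E}^3$ be a smooth curve with nonzero tangent vectors (the central curve) and let $r>0$. The tubular surface of radius $r$ around $\gamma$ is the union of all circles of radius $r$ and center $\gamma(s)$ contained in the planes through $\gamma(s)$ normal to $\gamma'(s)$, $s\in(a,b)$; it is parametrized by the pairs $(s,v)$ with $v$ a unit vector orthogonal to $\gamma'(s)$, via $(s,v)\mapsto\gamma(s)+rv$. It is called regular if $\gamma$ is parametrized by arc length and $1-r\kappa(s)\cos t\neq0$ for all $(s,t)\in(a,b)\times\mathbb{R}$, where $\kappa=\|\gamma''\|$; the parametrization is then an immersion, and $K$ and $H$ are the Gaussian and mean curvatures of this immersed surface. A right cylinder is a regular tubular surface with $\kappa\equiv0$. *)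

theory Defs
  imports "HOL-Analysis.Analysis"
begin

definition dir_deriv ::
  "'a::euclidean_space \<Rightarrow> ('a \<Rightarrow> 'b::euclidean_space) \<Rightarrow> 'a \<Rightarrow> 'b"
  where "dir_deriv v f x = frechet_derivative f (at x) v"

text \<open>C-infinity smoothness; only meant for open \<open>S\<close>. Every iterated directional
  derivative is required to be Frechet differentiable, so all of them are also continuous.\<close>

definition smooth_on :: "'a::euclidean_space set \<Rightarrow> ('a \<Rightarrow> 'b::euclidean_space) \<Rightarrow> bool"
  where "smooth_on S f \<longleftrightarrow> (\<forall>vs. \<forall>x\<in>S. foldr dir_deriv vs f differentiable (at x))"


section \<open>Curvatures of a parametrized surface in Euclidean 3-space\<close>

abbreviation partial_deriv ::
  "2 \<Rightarrow> (real^2 \<Rightarrow> 'b::euclidean_space) \<Rightarrow> real^2 \<Rightarrow> 'b"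
  where "partial_deriv i \<equiv> dir_deriv (axis i 1)"

definition unit_normal :: "(real^2 \<Rightarrow> real^3) \<Rightarrow> real^2 \<Rightarrow> real^3"
  where "unit_normal X p = sgn (cross3 (partial_deriv 1 X p) (partial_deriv 2 X p))"

definition first_fundamental_form :: "(real^2 \<Rightarrow> real^3) \<Rightarrow> real^2 \<Rightarrow> real^2^2"
  where "first_fundamental_form X p = (\<chi> i j. partial_deriv i X p \<bullet> partial_deriv j X p)"

definition second_fundamental_form :: "(real^2 \<Rightarrow> real^3) \<Rightarrow> real^2 \<Rightarrow> real^2^2"
  where "second_fundamental_form X p =
    (\<chi> i j. partial_deriv i (partial_deriv j X) p \<bullet> unit_normal X p)"

text \<open>Matrix of the shape operator in the basis of partial derivatives; its eigenvalues are
  the principal curvatures.\<close>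

definition shape_operator :: "(real^2 \<Rightarrow> real^3) \<Rightarrow> real^2 \<Rightarrow> real^2^2"
  where "shape_operator X p =
    matrix_inv (first_fundamental_form X p) ** second_fundamental_form X p"

definition gaussian_curvature :: "(real^2 \<Rightarrow> real^3) \<Rightarrow> real^2 \<Rightarrow> real"
  where "gaussian_curvature X p = det (shape_operator X p)"

definition mean_curvature :: "(real^2 \<Rightarrow> real^3) \<Rightarrow> real^2 \<Rightarrow> real"
  where "mean_curvature X p = trace (shape_operator X p) / 2"


section \<open>Immersed surfaces\<close>

text \<open>Local parametrizations of a smooth two-dimensional submanifold \<open>N\<close> of a Euclidean
  space: smooth maps with injective derivative from an open subset of the plane into \<open>N\<close>.\<close>

definition local_parametrization ::
  "'a::euclidean_space set \<Rightarrow> (real^2) set \<Rightarrow> (real^2 \<Rightarrow> 'a) \<Rightarrow> bool"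
  where "local_parametrization N U \<phi> \<longleftrightarrow>
    open U \<and> smooth_on U \<phi> \<and> \<phi> ` U \<subseteq> N \<and> (\<forall>p\<in>U. inj (frechet_derivative \<phi> (at p)))"

text \<open>The length of the second fundamental form of an immersion \<open>f\<close> of \<open>N\<close> at \<open>q\<close>.
  Changing the local parametrization preserves \<open>K\<close> and changes \<open>H\<close> at most by a sign,
  so the value does not depend on the choice of \<open>\<phi>\<close>.\<close>

definition second_ff_length ::
  "'a::euclidean_space set \<Rightarrow> ('a \<Rightarrow> real^3) \<Rightarrow> 'a \<Rightarrow> real"
  where "second_ff_length N f q =
    (THE l. \<exists>U \<phi> p. local_parametrization N U \<phi> \<and> p \<in> U \<and> \<phi> p = q \<and>
       l = sqrt (4 * (mean_curvature (f \<circ> \<phi>) p)\<^sup>2 - 2 * gaussian_curvature (f \<circ> \<phi>) p))"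


section \<open>Tubular surfaces\<close>

definition velocity :: "(real \<Rightarrow> real^3) \<Rightarrow> real \<Rightarrow> real^3"
  where "velocity \<gamma> s = vector_derivative \<gamma> (at s)"

text \<open>The curvature of a curve parametrized by arc length.\<close>

definition curve_curvature :: "(real \<Rightarrow> real^3) \<Rightarrow> real \<Rightarrow> real"
  where "curve_curvature \<gamma> s = norm (velocity (velocity \<gamma>) s)"

text \<open>A tubular surface is given by its central curve \<open>\<gamma>\<close>, defined on the bounded or unbounded
  open interval from \<open>a\<close> to \<open>b\<close>, and its radius \<open>r\<close>.\<close>

definition tubular_surface :: "ereal \<Rightarrow> ereal \<Rightarrow> (real \<Rightarrow> real^3) \<Rightarrow> real \<Rightarrow> bool"
  where "tubular_surface a b \<gamma> r \<longleftrightarrow>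
    a < b \<and> smooth_on (einterval a b) \<gamma> \<and> (\<forall>s\<in>einterval a b. velocity \<gamma> s \<noteq> 0) \<and> 0 < r"

definition unit_normal_bundle ::
  "ereal \<Rightarrow> ereal \<Rightarrow> (real \<Rightarrow> real^3) \<Rightarrow> (real \<times> (real^3)) set"
  where "unit_normal_bundle a b \<gamma> =
    {(s, v). s \<in> einterval a b \<and> norm v = 1 \<and> v \<bullet> velocity \<gamma> s = 0}"

definition tube_map :: "(real \<Rightarrow> real^3) \<Rightarrow> real \<Rightarrow> real \<times> (real^3) \<Rightarrow> real^3"
  where "tube_map \<gamma> r = (\<lambda>(s, v). \<gamma> s + r *\<^sub>R v)"

definition regular_tubular_surface :: "ereal \<Rightarrow> ereal \<Rightarrow> (real \<Rightarrow> real^3) \<Rightarrow> real \<Rightarrow> bool"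
  where "regular_tubular_surface a b \<gamma> r \<longleftrightarrow>
    tubular_surface a b \<gamma> r \<and>
    (\<forall>s\<in>einterval a b. norm (velocity \<gamma> s) = 1) \<and>
    (\<forall>s\<in>einterval a b. \<forall>t. 1 - r * curve_curvature \<gamma> s * cos t \<noteq> 0)"

definition right_cylinder :: "ereal \<Rightarrow> ereal \<Rightarrow> (real \<Rightarrow> real^3) \<Rightarrow> real \<Rightarrow> bool"
  where "right_cylinder a b \<gamma> r \<longleftrightarrow>
    regular_tubular_surface a b \<gamma> r \<and> (\<forall>s\<in>einterval a b. curve_curvature \<gamma> s = 0)"

definition tube_second_ff_length ::
  "ereal \<Rightarrow> ereal \<Rightarrow> (real \<Rightarrow> real^3) \<Rightarrow> real \<Rightarrow> real \<times> (real^3) \<Rightarrow> real"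
  where "tube_second_ff_length a b \<gamma> r =
    second_ff_length (unit_normal_bundle a b \<gamma>) (tube_map \<gamma> r)"

end

theory Submission
  imports Defs
begin

text \<open>Let \<open>k = \<gamma>''(s) \<bullet> v\<close>. The vector \<open>v\<close> is normal to the tube at \<open>(s, v)\<close>, and for any local parametrization
  \<open>(\<sigma>, \<nu>)\<close> of the unit normal bundle, differentiating \<open>\<nu> \<bullet> \<gamma>'(\<sigma>) = 0\<close> shows that the principal
  curvatures are \<open>1 / r\<close> and \<open>- k / (1 - r k)\<close> up to a common sign. Hence
  \<open>|A|\<^sup>2 = 1 / r\<^sup>2 + (k / (1 - r k))\<^sup>2\<close>. Over a point with \<open>\<gamma>'' \<noteq> 0\<close> this takes different values at
  \<open>v\<close> orthogonal to \<open>\<gamma>''\<close> and at \<open>v\<close> parallel to \<open>\<gamma>''\<close>, so constant length forces \<open>\<gamma>'' = 0\<close>.\<close>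


section \<open>Calculus of smooth maps\<close>

lemma dir_deriv_eqI:
  "(f has_derivative D) (at x) \<Longrightarrow> dir_deriv v f x = D v"
  by (simp add: dir_deriv_def frechet_derivative_at[symmetric])

lemma has_derivative_dir_deriv:
  "f differentiable at x \<Longrightarrow> (f has_derivative (\<lambda>v. dir_deriv v f x)) (at x)"
  unfolding dir_deriv_def using frechet_derivative_works[of f "at x"] by simp

text \<open>Smoothness cut off at order \<open>n\<close>, recursing on the derivative taken first.
  Closure properties then follow by induction on \<open>n\<close>, because the rules of calculus
  return maps of the same kind one order lower.\<close>

primrec times_differentiable_on ::
  "nat \<Rightarrow> 'a::euclidean_space set \<Rightarrow> ('a \<Rightarrow> 'b::euclidean_space) \<Rightarrow> bool"
  where
    "times_differentiable_on 0 S f \<longleftrightarrow> True"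
  | "times_differentiable_on (Suc n) S f \<longleftrightarrow>
      (\<forall>x\<in>S. f differentiable at x) \<and> (\<forall>v. times_differentiable_on n S (dir_deriv v f))"

text \<open>\<open>foldr\<close> applies the last entry of the list first, so one step of the
  recursion corresponds to a list \<open>vs @ [v]\<close>, split at its end.\<close>

lemma times_differentiable_on_iff:
  "times_differentiable_on n S f \<longleftrightarrow>
    (\<forall>vs. length vs < n \<longrightarrow> (\<forall>x\<in>S. foldr dir_deriv vs f differentiable at x))"
proof (induction n arbitrary: f)
  case (Suc n)
  show ?case
  proof
    assume L: "times_differentiable_on (Suc n) S f"
    show "\<forall>vs. length vs < Suc n \<longrightarrow> (\<forall>x\<in>S. foldr dir_deriv vs f differentiable at x)"
    proof (intro allI impI)
      fix vs :: "'a list"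
      assume "length vs < Suc n"
      then show "\<forall>x\<in>S. foldr dir_deriv vs f differentiable at x"
        using L Suc.IH by (cases vs rule: rev_cases) auto
    qed
  next
    assume R: "\<forall>vs. length vs < Suc n \<longrightarrow> (\<forall>x\<in>S. foldr dir_deriv vs f differentiable at x)"
    have "\<forall>x\<in>S. foldr dir_deriv vs (dir_deriv v f) differentiable at x" if "length vs < n" for v vs
      using R[rule_format, of "vs @ [v]"] that by simp
    then show "times_differentiable_on (Suc n) S f"
      using R[rule_format, of "[]"] by (simp add: Suc.IH)
  qed
qed simp

lemma smooth_on_iff_times_differentiable:
  "smooth_on S f \<longleftrightarrow> (\<forall>n. times_differentiable_on n S f)"
  unfolding smooth_on_def times_differentiable_on_iff by (meson lessI)

lemma times_differentiable_on_Suc_D: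
  "times_differentiable_on (Suc n) S f \<Longrightarrow> times_differentiable_on n S f"
  by (auto simp: times_differentiable_on_iff)

lemma differentiable_cong_open:
  assumes "open S" "x \<in> S" "\<And>x. x \<in> S \<Longrightarrow> f x = g x" "f differentiable at x"
  shows "g differentiable at x" "dir_deriv v g x = dir_deriv v f x"
proof -
  have "(g has_derivative (\<lambda>v. dir_deriv v f x)) (at x)"
    using has_derivative_transform_within_open[OF has_derivative_dir_deriv[OF assms(4)] assms(1,2)]
      assms(3) by auto
  then show "g differentiable at x" "dir_deriv v g x = dir_deriv v f x"
    by (auto simp: differentiable_def dest: dir_deriv_eqI)
qed

lemma times_differentiable_on_cong:
  assumes "open S" "\<And>x. x \<in> S \<Longrightarrow> f x = g x" "times_differentiable_on n S f"
  shows "times_differentiable_on n S g"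
  using assms
proof (induction n arbitrary: f g)
  case (Suc n)
  have "times_differentiable_on n S (dir_deriv v g)" for v
    by (rule Suc.IH[of "dir_deriv v f"])
      (use Suc.prems differentiable_cong_open[of S _ f g] in auto)
  then show ?case
    using Suc.prems differentiable_cong_open(1)[of S _ f g] by auto
qed simp

text \<open>The working form of the recursion. The formula \<open>f' v\<close> may differ from
  \<open>dir_deriv v f\<close> off \<open>S\<close>; this is harmless since differentiability on an
  open set is local.\<close>

lemma times_differentiable_on_SucI:
  assumes S: "open S"
    and D: "\<And>x. x \<in> S \<Longrightarrow> (f has_derivative (\<lambda>v. f' v x)) (at x)"
    and f': "\<And>v. times_differentiable_on n S (f' v)"
  shows "times_differentiable_on (Suc n) S f"
proof -
  have "times_differentiable_on n S (dir_deriv v f)" for v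
    by (rule times_differentiable_on_cong[OF S _ f'[of v]]) (simp add: dir_deriv_eqI[OF D])
  then show ?thesis
    using D by (auto simp: differentiable_def)
qed

lemma smooth_on_cong:
  "open S \<Longrightarrow> (\<And>x. x \<in> S \<Longrightarrow> f x = g x) \<Longrightarrow> smooth_on S f \<Longrightarrow> smooth_on S g"
  using times_differentiable_on_cong by (metis smooth_on_iff_times_differentiable)

lemma smooth_on_subset: "smooth_on S f \<Longrightarrow> T \<subseteq> S \<Longrightarrow> smooth_on T f"
  by (auto simp: smooth_on_def)

lemma smooth_on_differentiable: "smooth_on S f \<Longrightarrow> x \<in> S \<Longrightarrow> f differentiable at x"
  unfolding smooth_on_def by (metis foldr_Nil id_apply)

lemma smooth_on_dir_deriv: "smooth_on S f \<Longrightarrow> smooth_on S (dir_deriv v f)"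
  by (metis smooth_on_iff_times_differentiable times_differentiable_on.simps(2))

section \<open>Closure properties of smooth maps\<close>

lemma times_differentiable_on_const:
  assumes "open S"
  shows "times_differentiable_on n S (\<lambda>x. c)"
proof (induction n arbitrary: c)
  case (Suc n)
  show ?case
    by (rule times_differentiable_on_SucI[OF assms, of _ "\<lambda>v x. 0"]) (use Suc in auto)
qed simp

lemma smooth_on_const: "open S \<Longrightarrow> smooth_on S (\<lambda>x. c)"
  by (simp add: smooth_on_iff_times_differentiable times_differentiable_on_const)

lemma smooth_on_bounded_linear:
  assumes "open S" "bounded_linear L"
  shows "smooth_on S L"
  unfolding smooth_on_iff_times_differentiable
proof
  fix n
  show "times_differentiable_on n S L"
  proof (cases n)
    case (Suc m)
    show ?thesis
      unfolding Suc by (rule times_differentiable_on_SucI[OF assms(1), of _ "\<lambda>v x. L v"])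
        (use assms bounded_linear_imp_has_derivative times_differentiable_on_const in auto)
  qed simp
qed

lemma times_differentiable_on_bounded_linear_compose:
  assumes "open S" "bounded_linear L" "times_differentiable_on n S f"
  shows "times_differentiable_on n S (\<lambda>x. L (f x))"
  using assms(3)
proof (induction n arbitrary: f)
  case (Suc n)
  show ?case
    by (rule times_differentiable_on_SucI[OF assms(1), of _ "\<lambda>v x. L (dir_deriv v f x)"])
      (use Suc in \<open>auto intro!: bounded_linear.has_derivative[OF assms(2)] has_derivative_dir_deriv\<close>)
qed simp

lemma smooth_on_bounded_linear_compose:
  "open S \<Longrightarrow> bounded_linear L \<Longrightarrow> smooth_on S f \<Longrightarrow> smooth_on S (\<lambda>x. L (f x))"
  by (simp add: smooth_on_iff_times_differentiable times_differentiable_on_bounded_linear_compose)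

lemma times_differentiable_on_add:
  assumes "open S" "times_differentiable_on n S f" "times_differentiable_on n S g"
  shows "times_differentiable_on n S (\<lambda>x. f x + g x)"
  using assms(2,3)
proof (induction n arbitrary: f g)
  case (Suc n)
  show ?case
    by (rule times_differentiable_on_SucI[OF assms(1), of _ "\<lambda>v x. dir_deriv v f x + dir_deriv v g x"])
      (use Suc in \<open>auto intro!: has_derivative_add has_derivative_dir_deriv\<close>)
qed simp

lemma smooth_on_add:
  "open S \<Longrightarrow> smooth_on S f \<Longrightarrow> smooth_on S g \<Longrightarrow> smooth_on S (\<lambda>x. f x + g x)"
  by (simp add: smooth_on_iff_times_differentiable times_differentiable_on_add)

text \<open>Both terms of the Leibniz rule are again values of \<open>B\<close>, now on maps that
  are \<open>n\<close> times differentiable. Products, scalar multiples and inner products are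
  instances.\<close>

lemma times_differentiable_on_bilinear:
  assumes "open S" "bounded_bilinear B"
    and "times_differentiable_on n S f" "times_differentiable_on n S g"
  shows "times_differentiable_on n S (\<lambda>x. B (f x) (g x))"
  using assms(3,4)
proof (induction n arbitrary: f g)
  case (Suc n)
  show ?case
  proof (rule times_differentiable_on_SucI[OF assms(1),
      of _ "\<lambda>v x. B (f x) (dir_deriv v g x) + B (dir_deriv v f x) (g x)"])
    show "((\<lambda>x. B (f x) (g x)) has_derivative
      (\<lambda>v. B (f x) (dir_deriv v g x) + B (dir_deriv v f x) (g x))) (at x)" if "x \<in> S" for x
      by (intro bounded_bilinear.FDERIV[OF assms(2)] has_derivative_dir_deriv) (use Suc that in auto)
    show "times_differentiable_on n S
      (\<lambda>x. B (f x) (dir_deriv v g x) + B (dir_deriv v f x) (g x))" for v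
      using Suc.prems[THEN times_differentiable_on_Suc_D] Suc.prems
      by (intro times_differentiable_on_add assms(1) Suc.IH) auto
  qed
qed simp

lemma smooth_on_bilinear:
  "open S \<Longrightarrow> bounded_bilinear B \<Longrightarrow> smooth_on S f \<Longrightarrow> smooth_on S g \<Longrightarrow>
    smooth_on S (\<lambda>x. B (f x) (g x))"
  by (simp add: smooth_on_iff_times_differentiable times_differentiable_on_bilinear)

text \<open>The derivative is a product of derivatives of \<open>f\<close> and the reciprocal
  itself, so the induction hypothesis applies to the very same function.\<close>

lemma smooth_on_inverse:
  fixes f :: "'a::euclidean_space \<Rightarrow> real"
  assumes S: "open S" and f: "smooth_on S f" and nz: "\<And>x. x \<in> S \<Longrightarrow> f x \<noteq> 0"
  shows "smooth_on S (\<lambda>x. inverse (f x))"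
  unfolding smooth_on_iff_times_differentiable
proof
  fix n
  show "times_differentiable_on n S (\<lambda>x. inverse (f x))"
  proof (induction n)
    case (Suc n)
    show ?case
    proof (rule times_differentiable_on_SucI[OF S,
        of _ "\<lambda>v x. - (inverse (f x) * dir_deriv v f x * inverse (f x))"])
      show "((\<lambda>x. inverse (f x)) has_derivative
        (\<lambda>v. - (inverse (f x) * dir_deriv v f x * inverse (f x)))) (at x)" if "x \<in> S" for x
        using that nz by (intro Deriv.has_derivative_inverse has_derivative_dir_deriv)
          (auto intro: smooth_on_differentiable[OF f])
      show "times_differentiable_on n S (\<lambda>x. - (inverse (f x) * dir_deriv v f x * inverse (f x)))" for v
        using smooth_on_dir_deriv[OF f, of v] unfolding smooth_on_iff_times_differentiable
        by (intro times_differentiable_on_bounded_linear_compose[OF S bounded_linear_minus[OF bounded_linear_ident]]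
          times_differentiable_on_bilinear[OF S bounded_bilinear_mult] Suc) auto
    qed
  qed simp
qed

lemma has_derivative_dir_deriv_real:
  fixes g :: "real \<Rightarrow> 'b::euclidean_space"
  assumes "g differentiable at s"
  shows "(g has_derivative (\<lambda>w. w *\<^sub>R dir_deriv 1 g s)) (at s)"
proof -
  note D = has_derivative_dir_deriv[OF assms]
  have "dir_deriv w g s = w *\<^sub>R dir_deriv 1 g s" for w
    using linear_scale[OF has_derivative_linear[OF D], of w 1] by simp
  then have "(\<lambda>w. dir_deriv w g s) = (\<lambda>w. w *\<^sub>R dir_deriv 1 g s)"
    by (intro ext)
  then show ?thesis
    using D by metis
qed

lemma has_derivative_compose_real:
  fixes g :: "real \<Rightarrow> 'b::euclidean_space" and h :: "'a::euclidean_space \<Rightarrow> real"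
  assumes "g differentiable at (h x)" "h differentiable at x"
  shows "((\<lambda>x. g (h x)) has_derivative (\<lambda>v. dir_deriv v h x *\<^sub>R dir_deriv 1 g (h x))) (at x)"
  by (rule has_derivative_compose[OF has_derivative_dir_deriv[OF assms(2)]
        has_derivative_dir_deriv_real[OF assms(1)]])

text \<open>By the chain rule the derivative is a scalar factor times the composition of
  \<open>dir_deriv 1 g\<close> with \<open>h\<close>; hence the induction keeps \<open>h\<close>
  fixed and varies \<open>g\<close>.\<close>

lemma smooth_on_compose_real:
  fixes g :: "real \<Rightarrow> 'b::euclidean_space" and h :: "'a::euclidean_space \<Rightarrow> real"
  assumes S: "open S" and g: "smooth_on J g" and h: "smooth_on S h" "h ` S \<subseteq> J"
  shows "smooth_on S (\<lambda>x. g (h x))"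
  unfolding smooth_on_iff_times_differentiable
proof
  fix n
  show "times_differentiable_on n S (\<lambda>x. g (h x))"
    using g
  proof (induction n arbitrary: g)
    case (Suc n)
    show ?case
    proof (rule times_differentiable_on_SucI[OF S,
        of _ "\<lambda>v x. dir_deriv v h x *\<^sub>R dir_deriv 1 g (h x)"])
      show "((\<lambda>x. g (h x)) has_derivative (\<lambda>v. dir_deriv v h x *\<^sub>R dir_deriv 1 g (h x))) (at x)"
        if "x \<in> S" for x
        using that h Suc.prems
        by (intro has_derivative_compose_real) (auto intro!: smooth_on_differentiable)
      show "times_differentiable_on n S (\<lambda>x. dir_deriv v h x *\<^sub>R dir_deriv 1 g (h x))" for v
        using smooth_on_dir_deriv[OF h(1)] smooth_on_dir_deriv[OF Suc.prems]
        by (intro times_differentiable_on_bilinear[OF S bounded_bilinear_scaleR] Suc.IH)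
          (auto simp: smooth_on_iff_times_differentiable)
    qed
  qed simp
qed

lemma smooth_on_sin_cos: "smooth_on UNIV (sin :: real \<Rightarrow> real)" "smooth_on UNIV (cos :: real \<Rightarrow> real)"
proof -
  \<comment> \<open>Simultaneous induction: up to sign, each function is the derivative of the
    other.\<close>
  have "times_differentiable_on n UNIV (sin :: real \<Rightarrow> real) \<and>
    times_differentiable_on n UNIV (cos :: real \<Rightarrow> real)" for n
  proof (induction n)
    case (Suc n)
    have "times_differentiable_on (Suc n) UNIV (sin :: real \<Rightarrow> real)"
    proof (rule times_differentiable_on_SucI[of _ _ "\<lambda>v x. v * cos x"])
      show "times_differentiable_on n UNIV (\<lambda>x. v * cos x)" for v :: real
        using Suc by (intro times_differentiable_on_bounded_linear_compose[OF _ bounded_linear_mult_right])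
          auto
    qed (auto intro!: derivative_eq_intros)
    moreover have "times_differentiable_on (Suc n) UNIV (cos :: real \<Rightarrow> real)"
    proof (rule times_differentiable_on_SucI[of _ _ "\<lambda>v x. - v * sin x"])
      show "times_differentiable_on n UNIV (\<lambda>x. - v * sin x)" for v :: real
        using Suc by (intro times_differentiable_on_bounded_linear_compose[OF _ bounded_linear_mult_right])
          auto
    qed (auto intro!: derivative_eq_intros)
    ultimately show ?case by blast
  qed simp
  then show "smooth_on UNIV (sin :: real \<Rightarrow> real)" "smooth_on UNIV (cos :: real \<Rightarrow> real)"
    by (auto simp: smooth_on_iff_times_differentiable)
qed

lemma smooth_on_Pair:
  fixes f :: "'a::euclidean_space \<Rightarrow> 'b::euclidean_space"
    and g :: "'a \<Rightarrow> 'c::euclidean_space"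
  assumes S: "open S" and f: "smooth_on S f" and g: "smooth_on S g"
  shows "smooth_on S (\<lambda>x. (f x, g x))"
proof -
  have L: "bounded_linear (\<lambda>y::'b. (y, 0::'c))" "bounded_linear (\<lambda>z::'c. (0::'b, z))"
    by (rule bounded_linear_Pair[OF bounded_linear_ident bounded_linear_zero]
        bounded_linear_Pair[OF bounded_linear_zero bounded_linear_ident])+
  have "smooth_on S (\<lambda>x. (f x, 0::'c) + (0::'b, g x))"
    by (rule smooth_on_add[OF S smooth_on_bounded_linear_compose[OF S L(1) f]
          smooth_on_bounded_linear_compose[OF S L(2) g]])
  then show ?thesis
    by simp
qed


section \<open>Linear algebra in dimensions 2 and 3\<close>

lemma matrix_inv_eqI:
  fixes A :: "'a::field^'n^'n"
  assumes "B ** A = mat 1"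
  shows "matrix_inv A = B"
proof -
  have "A ** B = mat 1"
    using assms matrix_left_right_inverse by blast
  \<comment> \<open>\<open>matrix_inv\<close> is a choice among two-sided inverses, so its property
    becomes available once one of them, here \<open>B\<close>, is exhibited.\<close>
  then have "A ** matrix_inv A = mat 1"
    using assms unfolding matrix_inv_def by (metis (mono_tags, lifting) someI)
  then have "B ** A ** matrix_inv A = B"
    by (metis matrix_mul_assoc matrix_mul_rid)
  then show ?thesis
    using assms by simp
qed

text \<open>This is \<open>M^T D M\<close> with \<open>D = diag(x, y)\<close> and \<open>M\<close>
  the matrix with rows \<open>p\<close> and \<open>q\<close>. Both fundamental forms of a tube have
  this shape with a common \<open>M\<close>.\<close>

definition diag_form :: "real^2 \<Rightarrow> real^2 \<Rightarrow> real \<Rightarrow> real \<Rightarrow> real^2^2" where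
  "diag_form p q x y = (\<chi> i j. x * p$i * p$j + y * q$i * q$j)"

text \<open>The inverse of \<open>M^T D M\<close> times \<open>M^T D' M\<close> is
  \<open>M^-1 D^-1 D' M\<close>, which is similar to the diagonal matrix with entries
  \<open>x' / x\<close> and \<open>y' / y\<close>.\<close>

lemma trace_det_diag_form:
  fixes p q :: "real^2"
  assumes xy: "x \<noteq> 0" "y \<noteq> 0" and d: "p$1 * q$2 - p$2 * q$1 \<noteq> 0"
  shows "trace (matrix_inv (diag_form p q x y) ** diag_form p q x' y') = x' / x + y' / y" (is ?tr)
    and "det (matrix_inv (diag_form p q x y) ** diag_form p q x' y') = (x' / x) * (y' / y)" (is ?det)
proof -
  define e where "e = 1 / (p$1 * q$2 - p$2 * q$1)"
  have e: "(p$1 * q$2 - p$2 * q$1) * e = 1"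
    using d by (simp add: e_def)
  \<comment> \<open>The basis dual to \<open>p\<close>, \<open>q\<close>: the columns of
    \<open>M^-1\<close> by Cramer's rule.\<close>
  define p' q' :: "real^2" where "p' = vector [q$2 * e, - q$1 * e]" and "q' = vector [- p$2 * e, p$1 * e]"
  have dual: "p$1 * p'$1 + p$2 * p'$2 = 1" "q$1 * q'$1 + q$2 * q'$2 = 1"
     "q$1 * p'$1 + q$2 * p'$2 = 0" "p$1 * q'$1 + p$2 * q'$2 = 0"
     "p'$1 * q'$2 - p'$2 * q'$1 = e"
    using e unfolding p'_def q'_def by (simp_all, algebra+)
  \<comment> \<open>\<open>C u w\<close> is \<open>M^-1 diag(u, w) M\<close>.\<close>
  define C where "C u w = (\<chi> i j. u * p'$i * p$j + w * q'$i * q$j)" for u w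
  have *: "diag_form p' q' (1/x) (1/y) ** diag_form p q u w = C (u/x) (w/y)" for u w
  proof -
    have "(diag_form p' q' (1/x) (1/y) ** diag_form p q u w) $ i $ j = C (u/x) (w/y) $ i $ j" for i j
    proof -
      have "(diag_form p' q' (1/x) (1/y) ** diag_form p q u w) $ i $ j =
        p'$i/x * u * p$j * (p$1 * p'$1 + p$2 * p'$2) + p'$i/x * w * q$j * (q$1 * p'$1 + q$2 * p'$2)
        + q'$i/y * u * p$j * (p$1 * q'$1 + p$2 * q'$2) + q'$i/y * w * q$j * (q$1 * q'$1 + q$2 * q'$2)"
        by (simp add: matrix_matrix_mult_def diag_form_def sum_2 algebra_simps)
      then show ?thesis
        unfolding dual C_def by (simp add: ac_simps)
    qed
    then show ?thesis by (simp add: vec_eq_iff)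
  qed
  have C1: "C 1 1 = mat 1"
    using e unfolding C_def p'_def q'_def mat_def
    by (simp add: vec_eq_iff forall_2 algebra_simps)
  then have "diag_form p' q' (1/x) (1/y) ** diag_form p q x y = mat 1"
    using *[of x y] xy by simp
  then have inv: "matrix_inv (diag_form p q x y) = diag_form p' q' (1/x) (1/y)"
    by (rule matrix_inv_eqI)
  have "trace (C u w) = u * (p$1 * p'$1 + p$2 * p'$2) + w * (q$1 * q'$1 + q$2 * q'$2)" for u w
    by (simp add: C_def trace_def sum_2 algebra_simps)
  then show ?tr
    unfolding inv * dual by simp
  have "det (C u w) = u * w * ((p'$1 * q'$2 - p'$2 * q'$1) * (p$1 * q$2 - p$2 * q$1))" for u w
    by (simp add: C_def det_2 algebra_simps)
  then show ?det
    unfolding inv * dual using e by (simp add: mult.commute)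
qed

lemma common_kernel_2:
  fixes a b c d :: real
  assumes "a * d = b * c"
  obtains h :: "real^2" where "h \<noteq> 0" "h$1 * a + h$2 * b = 0" "h$1 * c + h$2 * d = 0"
proof -
  \<comment> \<open>A nonzero row turned by a right angle lies in the kernel of both proportional
    rows; if both rows vanish, any vector does.\<close>
  consider "b \<noteq> 0 \<or> a \<noteq> 0" | "a = 0" "b = 0" "d \<noteq> 0 \<or> c \<noteq> 0" | "a = 0" "b = 0" "c = 0" "d = 0"
    by blast
  then show thesis
  proof cases
    case 1
    then show thesis
      using that[of "vector [b, -a]"] assms by (auto simp: vec_eq_iff forall_2 algebra_simps)
  next
    case 2
    then show thesis
      using that[of "vector [d, -c]"] by (auto simp: vec_eq_iff forall_2 algebra_simps)
  next
    case 3
    then show thesis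
      using that[of "axis 1 1"] by auto
  qed
qed

lemma cross3_frame:
  fixes T n :: "real^3"
  assumes T: "norm T = 1" and n: "norm n = 1" and "n \<bullet> T = 0"
  defines "B \<equiv> cross3 n T"
  shows "norm B = 1" "B \<bullet> T = 0" "cross3 T B = n"
    and "w \<bullet> n = 0 \<Longrightarrow> w = (w \<bullet> T) *\<^sub>R T + (w \<bullet> B) *\<^sub>R B"
proof -
  have TT: "T \<bullet> T = 1" "n \<bullet> n = 1"
    using T n by (simp_all add: norm_eq_1)
  have "(norm B)\<^sup>2 = 1"
    using norm_cross_dot[of n T] assms by (simp add: B_def)
  then show B: "norm B = 1"
    by (simp add: power2_eq_1_iff) (metis norm_ge_zero not_one_le_zero neg_0_le_iff_le)
  show BT: "B \<bullet> T = 0"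
    by (simp add: B_def dot_cross_self)
  show "cross3 T B = n"
    using TT assms(3) by (simp add: B_def Lagrange inner_commute)
  assume w: "w \<bullet> n = 0"
  \<comment> \<open>What remains of \<open>w\<close> after projection is orthogonal to
    \<open>T\<close>, \<open>B\<close> and \<open>n\<close>. As \<open>B\<close> is a cross product
    of \<open>n\<close> and \<open>T\<close>, the Lagrange identity also makes it parallel to
    \<open>B\<close>, so it vanishes.\<close>
  define u where "u = w - (w \<bullet> T) *\<^sub>R T - (w \<bullet> B) *\<^sub>R B"
  have "B \<bullet> B = 1" "B \<bullet> n = 0"
    using B by (simp_all add: norm_eq_1 B_def dot_cross_self)
  then have "u \<bullet> B = 0" "u \<bullet> T = 0" "u \<bullet> n = 0"
    using w TT BT assms(3) by (simp_all add: u_def inner_diff_left inner_diff_right inner_commute)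
  moreover from this have "cross3 u B = 0"
    by (simp add: B_def Lagrange)
  ultimately have "u = 0"
    using norm_cross_dot[of u B] B by simp
  then show "w = (w \<bullet> T) *\<^sub>R T + (w \<bullet> B) *\<^sub>R B"
    by (simp add: u_def algebra_simps)
qed


section \<open>Curvature of tubes\<close>

lemma velocity_eq_dir_deriv:
  assumes "\<gamma> differentiable at s"
  shows "velocity \<gamma> s = dir_deriv 1 \<gamma> s"
  unfolding velocity_def
  by (rule vector_derivative_at) (use has_derivative_dir_deriv_real[OF assms] in
    \<open>simp add: has_vector_derivative_def\<close>)

lemma smooth_on_velocity:
  assumes "open J" "smooth_on J \<gamma>"
  shows "smooth_on J (velocity \<gamma>)"
  by (rule smooth_on_cong[OF assms(1) _ smooth_on_dir_deriv[OF assms(2), of 1]])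
    (simp add: velocity_eq_dir_deriv smooth_on_differentiable[OF assms(2)])

lemma has_derivative_compose_velocity:
  assumes "\<gamma> differentiable at (h x)" "h differentiable at x"
  shows "((\<lambda>x. \<gamma> (h x)) has_derivative (\<lambda>v. dir_deriv v h x *\<^sub>R velocity \<gamma> (h x))) (at x)"
  using has_derivative_compose_real[OF assms] by (simp add: velocity_eq_dir_deriv[OF assms(1)])

text \<open>If \<open>r\<close> times the curvature were at least 1, its reciprocal would be the
  cosine of some \<open>t\<close>, against regularity. Cauchy-Schwarz passes from the curvature to
  the component of \<gamma>'' along \<open>v\<close>.\<close>

lemma regular_tube_curvature_less:
  assumes "regular_tubular_surface a b \<gamma> r" "(s, v) \<in> unit_normal_bundle a b \<gamma>"
  shows "r * (velocity (velocity \<gamma>) s \<bullet> v) < 1"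
proof -
  let ?k = "curve_curvature \<gamma> s"
  have r: "r > 0" and s: "s \<in> einterval a b" and v: "norm v = 1"
    using assms by (auto simp: regular_tubular_surface_def tubular_surface_def unit_normal_bundle_def)
  have "r * ?k < 1"
  proof (rule ccontr)
    assume k: "\<not> r * ?k < 1"
    then have "cos (arccos (1 / (r * ?k))) = 1 / (r * ?k)"
      by (intro cos_arccos) (auto simp: field_simps)
    then have "1 - r * ?k * cos (arccos (1 / (r * ?k))) = 0"
      using k by auto
    then show False
      using assms(1) s by (auto simp: regular_tubular_surface_def)
  qed
  moreover have "velocity (velocity \<gamma>) s \<bullet> v \<le> ?k"
    using norm_cauchy_schwarz[of "velocity (velocity \<gamma>) s" v] v by (simp add: curve_curvature_def)
  ultimately show ?thesis
    using r by (smt (verit) mult_left_mono)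
qed

text \<open>The product rule for a constant inner product. It serves for unit vector fields, for
  normality to the curve, and for moving a derivative from a tangent field onto the normal.\<close>

lemma dir_deriv_inner_constant:
  fixes f g :: "'a::euclidean_space \<Rightarrow> 'b::euclidean_space"
  assumes "open U" "x \<in> U" "\<And>y. y \<in> U \<Longrightarrow> f y \<bullet> g y = c"
    and "f differentiable at x" "g differentiable at x"
  shows "dir_deriv h f x \<bullet> g x = - (f x \<bullet> dir_deriv h g x)"
proof -
  have "((\<lambda>y. f y \<bullet> g y) has_derivative
      (\<lambda>h. f x \<bullet> dir_deriv h g x + dir_deriv h f x \<bullet> g x)) (at x)"
    by (intro has_derivative_inner has_derivative_dir_deriv assms)
  then have "((\<lambda>y. c) has_derivative
      (\<lambda>h. f x \<bullet> dir_deriv h g x + dir_deriv h f x \<bullet> g x)) (at x)"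
    by (rule has_derivative_transform_within_open[OF _ assms(1,2)]) (rule assms(3))
  then have "(\<lambda>h. f x \<bullet> dir_deriv h g x + dir_deriv h f x \<bullet> g x) = (\<lambda>h. 0)"
    by (rule has_derivative_unique) (rule has_derivative_const)
  then have "f x \<bullet> dir_deriv h g x + dir_deriv h f x \<bullet> g x = 0"
    by meson
  then show ?thesis
    by simp
qed

lemma dir_deriv_2:
  fixes f :: "real^2 \<Rightarrow> 'b::euclidean_space"
  assumes "f differentiable at x"
  shows "dir_deriv h f x = h$1 *\<^sub>R partial_deriv 1 f x + h$2 *\<^sub>R partial_deriv 2 f x"
proof -
  note lin = has_derivative_linear[OF has_derivative_dir_deriv[OF assms]]
  have "h = h$1 *\<^sub>R axis 1 1 + h$2 *\<^sub>R axis 2 1"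
    by (simp add: vec_eq_iff forall_2 axis_def)
  then have "dir_deriv h f x = dir_deriv (h$1 *\<^sub>R axis 1 1 + h$2 *\<^sub>R axis 2 1) f x"
    by metis
  then show ?thesis
    by (simp add: linear_add[OF lin] linear_scale[OF lin])
qed

text \<open>The right-hand side depends on \<open>(s, v)\<close> but not on \<open>\<phi>\<close>,
  which gives the uniqueness demanded by the definite description in
  \<open>second_ff_length\<close>.\<close>

lemma curvature_tube_local_parametrization:
  assumes reg: "regular_tubular_surface a b \<gamma> r"
    and \<phi>: "local_parametrization (unit_normal_bundle a b \<gamma>) U \<phi>"
    and p: "p \<in> U" "\<phi> p = (s, v)"
  defines "X \<equiv> tube_map \<gamma> r \<circ> \<phi>"
    and "k \<equiv> velocity (velocity \<gamma>) s \<bullet> v"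
  shows "4 * (mean_curvature X p)\<^sup>2 - 2 * gaussian_curvature X p = (1 / r)\<^sup>2 + (k / (1 - r * k))\<^sup>2"
proof -
  define J where "J = einterval a b"
  define T where "T = velocity \<gamma>"
  define \<sigma> where "\<sigma> = (\<lambda>x. fst (\<phi> x))"
  define \<nu> where "\<nu> = (\<lambda>x. snd (\<phi> x))"
  \<comment> \<open>The derivative of \<open>X\<close> in direction \<open>h\<close>, in closed form
    on \<open>U\<close>, so that it can be differentiated again.\<close>
  define Y where "Y = (\<lambda>h x. dir_deriv h \<sigma> x *\<^sub>R T (\<sigma> x) + r *\<^sub>R dir_deriv h \<nu> x)"
  have U: "open U" and J: "open J"
    using \<phi> by (auto simp: local_parametrization_def J_def)
  have r: "r > 0" and \<gamma>: "smooth_on J \<gamma>" and unit: "\<And>s. s \<in> J \<Longrightarrow> norm (T s) = 1"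
    using reg by (auto simp: regular_tubular_surface_def tubular_surface_def J_def T_def)
  have on_bundle: "\<sigma> x \<in> J" "norm (\<nu> x) = 1" "\<nu> x \<bullet> T (\<sigma> x) = 0" if "x \<in> U" for x
  proof -
    have "\<phi> x \<in> unit_normal_bundle a b \<gamma>"
      using \<phi> that by (auto simp: local_parametrization_def)
    then show "\<sigma> x \<in> J" "norm (\<nu> x) = 1" "\<nu> x \<bullet> T (\<sigma> x) = 0"
      by (auto simp: unit_normal_bundle_def \<sigma>_def \<nu>_def J_def T_def split: prod.splits)
  qed
  have \<phi>_smooth: "smooth_on U \<phi>"
    using \<phi> by (simp add: local_parametrization_def)
  have smooth: "smooth_on U \<sigma>" "smooth_on U \<nu>" "smooth_on J T"
    unfolding \<sigma>_def \<nu>_def T_def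
    by (rule smooth_on_bounded_linear_compose[OF U bounded_linear_fst \<phi>_smooth]
        smooth_on_bounded_linear_compose[OF U bounded_linear_snd \<phi>_smooth]
        smooth_on_velocity[OF J \<gamma>])+
  have T\<sigma>_smooth: "smooth_on U (\<lambda>x. T (\<sigma> x))"
    by (rule smooth_on_compose_real[OF U smooth(3,1)]) (use on_bundle in auto)
  have Y_smooth: "smooth_on U (Y h)" for h
    unfolding Y_def
    by (rule smooth_on_add[OF U] smooth_on_bilinear[OF U bounded_bilinear_scaleR]
      smooth_on_dir_deriv smooth smooth_on_const U T\<sigma>_smooth)+
  then have diff: "\<phi> differentiable at x" "\<sigma> differentiable at x" "\<nu> differentiable at x"
    "\<gamma> differentiable at (\<sigma> x)" "T differentiable at (\<sigma> x)" "Y h differentiable at x"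
    "(\<lambda>x. T (\<sigma> x)) differentiable at x" if "x \<in> U" for x h
    using that on_bundle(1)[OF that] smooth_on_differentiable[OF \<phi>_smooth]
      smooth_on_differentiable[OF \<gamma>] smooth[THEN smooth_on_differentiable]
      smooth_on_differentiable[OF T\<sigma>_smooth]
      smooth_on_differentiable[OF Y_smooth] by blast+
  have dX: "(X has_derivative (\<lambda>h. Y h x)) (at x)" if "x \<in> U" for x
  proof -
    have "X = (\<lambda>x. \<gamma> (\<sigma> x) + r *\<^sub>R \<nu> x)"
      by (simp add: X_def tube_map_def \<sigma>_def \<nu>_def fun_eq_iff split: prod.splits)
    then show ?thesis
      unfolding Y_def T_def
      by (auto intro!: has_derivative_add has_derivative_compose_velocity
        has_derivative_scaleR_right has_derivative_dir_deriv diff that)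
  qed
  have d\<nu>: "dir_deriv h \<nu> x \<bullet> \<nu> x = 0" if "x \<in> U" for h x
  proof -
    have "\<nu> y \<bullet> \<nu> y = 1" if "y \<in> U" for y
      using on_bundle(2)[OF that] by (simp add: norm_eq_1)
    then show ?thesis
      using dir_deriv_inner_constant[OF U that, of \<nu> \<nu> 1 h] diff that by (simp add: inner_commute)
  qed
  \<comment> \<open>Here the curvature of \<gamma> enters: differentiating
    \<open>\<nu> \<bullet> T(\<sigma>) = 0\<close> brings in the derivative of \<open>T\<close>,
    that is \<gamma>''.\<close>
  have d\<nu>T: "dir_deriv h \<nu> x \<bullet> T (\<sigma> x) = - (dir_deriv h \<sigma> x * (velocity T (\<sigma> x) \<bullet> \<nu> x))"
    if "x \<in> U" for h x
  proof -
    have "dir_deriv h (\<lambda>x. T (\<sigma> x)) x = dir_deriv h \<sigma> x *\<^sub>R velocity T (\<sigma> x)"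
      using that diff by (intro dir_deriv_eqI has_derivative_compose_velocity) auto
    then show ?thesis
      using dir_deriv_inner_constant[OF U that, of \<nu> "\<lambda>x. T (\<sigma> x)" 0 h] diff[OF that] on_bundle
      by (simp add: inner_commute)
  qed
  have YN: "Y h x \<bullet> \<nu> x = 0" if "x \<in> U" for h x
    using that d\<nu> on_bundle by (simp add: Y_def inner_add_left inner_add_right inner_commute)
  have XY: "dir_deriv h X x = Y h x" if "x \<in> U" for h x
    by (rule dir_deriv_eqI[OF dX[OF that]])
  \<comment> \<open>The Weingarten relation: the second fundamental form is expressed by first
    derivatives of \<open>X\<close> and of the normal \<open>\<nu>\<close>.\<close>
  have dY: "dir_deriv g (dir_deriv h X) p \<bullet> v = - (Y h p \<bullet> dir_deriv g \<nu> p)" for g h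
  proof -
    have "dir_deriv g (dir_deriv h X) p = dir_deriv g (Y h) p"
      by (rule differentiable_cong_open(2)[OF U p(1)])
        (use XY diff p in auto)
    then show ?thesis
      using dir_deriv_inner_constant[OF U p(1), of "Y h" \<nu> 0 g] diff[OF p(1)] YN p(2)
      by (simp add: \<nu>_def)
  qed

  have sv: "\<sigma> p = s" "\<nu> p = v"
    using p by (simp_all add: \<sigma>_def \<nu>_def)
  text \<open>In the orthonormal frame \<open>T s\<close>, \<open>B\<close> of the tangent plane the differentials of \<open>X\<close> and \<open>\<nu>\<close> are
    \<open>diag (m, r)\<close> and \<open>diag (-k, 1)\<close> times the matrix with rows \<open>u\<close> and \<open>w\<close>.\<close>
  define m where "m = 1 - r * k"
  define B where "B = cross3 v (T s)"
  define u :: "real^2" where "u = (\<chi> i. partial_deriv i \<sigma> p)"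
  define w :: "real^2" where "w = (\<chi> i. partial_deriv i \<nu> p \<bullet> B)"
  have "\<phi> p \<in> unit_normal_bundle a b \<gamma>"
    using \<phi> p(1) by (auto simp: local_parametrization_def)
  then have m: "m > 0"
    using regular_tube_curvature_less[OF reg] p(2) by (simp add: m_def k_def)
  have T1: "norm (T s) = 1" and v1: "norm v = 1" and vT: "v \<bullet> T s = 0"
    using on_bundle[OF p(1)] unit by (simp_all add: sv)
  note frame = cross3_frame[OF T1 v1 vT, folded B_def]
  have ip: "T s \<bullet> T s = 1" "B \<bullet> B = 1" "T s \<bullet> B = 0" "B \<bullet> T s = 0"
    using T1 frame by (simp_all add: norm_eq_1 inner_commute)
  have \<nu>i: "dir_deriv h \<nu> p = - (k * dir_deriv h \<sigma> p) *\<^sub>R T s + (dir_deriv h \<nu> p \<bullet> B) *\<^sub>R B" for h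
  proof -
    have "dir_deriv h \<nu> p \<bullet> v = 0" "dir_deriv h \<nu> p \<bullet> T s = - (k * dir_deriv h \<sigma> p)"
      using d\<nu>[OF p(1), of h] d\<nu>T[OF p(1), of h] by (simp_all add: sv k_def T_def)
    then show ?thesis
      using frame(4)[of "dir_deriv h \<nu> p"] by simp
  qed
  have \<nu>_axis: "partial_deriv i \<nu> p = - (k * u$i) *\<^sub>R T s + w$i *\<^sub>R B" for i
    using \<nu>i[of "axis i 1"] by (simp add: u_def w_def)
  have Y_axis: "Y (axis i 1) p = (m * u$i) *\<^sub>R T s + (r * w$i) *\<^sub>R B" for i
    unfolding Y_def \<nu>_axis sv by (simp add: u_def m_def algebra_simps)
  \<comment> \<open>If \<open>u\<close> and \<open>w\<close> were dependent, some
    \<open>h \<noteq> 0\<close> would be annihilated by the differentials of \<open>\<sigma>\<close>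
    and \<open>\<nu>\<close>, hence by that of \<open>\<phi>\<close>, which is injective.\<close>
  have nz: "u$1 * w$2 - u$2 * w$1 \<noteq> 0"
  proof
    assume "u$1 * w$2 - u$2 * w$1 = 0"
    then obtain h :: "real^2"
      where h: "h \<noteq> 0" "h$1 * u$1 + h$2 * u$2 = 0" "h$1 * w$1 + h$2 * w$2 = 0"
      using common_kernel_2[of "u$1" "w$2" "u$2" "w$1"] by auto
    have \<sigma>h: "dir_deriv h \<sigma> p = 0"
      using h(2) dir_deriv_2[OF diff(2)[OF p(1)], of h] by (simp add: u_def)
    have "dir_deriv h \<nu> p \<bullet> B = 0"
      using h(3) dir_deriv_2[OF diff(3)[OF p(1)], of h] by (simp add: w_def inner_add_left)
    then have \<nu>h: "dir_deriv h \<nu> p = 0"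
      using \<nu>i[of h] \<sigma>h by simp
    note d\<phi> = has_derivative_dir_deriv[OF diff(1)[OF p(1)]]
    have "dir_deriv h \<sigma> p = fst (dir_deriv h \<phi> p)" "dir_deriv h \<nu> p = snd (dir_deriv h \<phi> p)"
      unfolding \<sigma>_def \<nu>_def by (intro dir_deriv_eqI has_derivative_fst has_derivative_snd d\<phi>)+
    then have "frechet_derivative \<phi> (at p) h = frechet_derivative \<phi> (at p) 0"
      using \<sigma>h \<nu>h linear_0[OF linear_frechet_derivative[OF diff(1)[OF p(1)]]]
      by (simp add: prod_eq_iff dir_deriv_def)
    moreover have "inj (frechet_derivative \<phi> (at p))"
      using \<phi> p(1) by (auto simp: local_parametrization_def)
    ultimately show False
      using h(1) by (meson injD)
  qed
  \<comment> \<open>The orientation of \<open>\<phi>\<close>: the unit normal of \<open>X\<close> is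
    \<open>v\<close> or \<open>-v\<close> according to this sign.\<close>
  define e where "e = sgn (m * r * (u$1 * w$2 - u$2 * w$1))"
  have e: "e * e = 1"
    using nz m r by (simp add: e_def sgn_if)
  have "cross3 (partial_deriv 1 X p) (partial_deriv 2 X p) = (m * r * (u$1 * w$2 - u$2 * w$1)) *\<^sub>R v"
  proof -
    have "cross3 B (T s) = - v"
      using frame(3) cross_skew[of B "T s"] by simp
    then show ?thesis
      unfolding XY[OF p(1)] Y_axis
      by (simp add: cross_add_left cross_add_right cross_mult_left cross_mult_right frame(3) algebra_simps)
  qed
  then have N: "unit_normal X p = e *\<^sub>R v"
    using v1 by (simp add: unit_normal_def sgn_scaleR e_def sgn_div_norm[of v])
  have I: "first_fundamental_form X p = diag_form u w (m\<^sup>2) (r\<^sup>2)"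
    unfolding first_fundamental_form_def diag_form_def XY[OF p(1)] Y_axis
    by (simp add: vec_eq_iff inner_add_left inner_add_right ip power2_eq_square)
  have II: "second_fundamental_form X p = diag_form u w (e * (m * k)) (- e * r)"
    unfolding second_fundamental_form_def diag_form_def N inner_scaleR_right dY Y_axis \<nu>_axis
    by (simp add: vec_eq_iff ip algebra_simps)
  \<comment> \<open>Dividing the diagonal entries of the two forms gives the principal curvatures
    \<open>e * k / m\<close> and \<open>- e / r\<close>.\<close>
  note tr_det = trace_det_diag_form[OF _ _ nz, of "m\<^sup>2" "r\<^sup>2" "e * (m * k)" "- e * r"]
  have tr: "trace (shape_operator X p) = e * (k / m) - e / r"
    using tr_det(1) m r by (simp add: shape_operator_def I II power2_eq_square)
  have dt: "det (shape_operator X p) = - ((k / m) * (1 / r))"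
    using tr_det(2) m r e by (simp add: shape_operator_def I II power2_eq_square field_simps)
  \<comment> \<open>The expression is trace squared minus twice the determinant, the sum of the
    squared principal curvatures; the sign \<open>e\<close> therefore cancels.\<close>
  have "4 * (mean_curvature X p)\<^sup>2 - 2 * gaussian_curvature X p
      = (trace (shape_operator X p))\<^sup>2 - 2 * det (shape_operator X p)"
    by (simp add: mean_curvature_def gaussian_curvature_def power_divide)
  also have "\<dots> = (e * e) * (k / m - 1 / r)\<^sup>2 + 2 * ((k / m) * (1 / r))"
    unfolding tr dt by (simp add: power2_eq_square algebra_simps diff_divide_distrib)
  also have "\<dots> = (1 / r)\<^sup>2 + (k / m)\<^sup>2"
    unfolding e by (simp add: power2_eq_square algebra_simps)
  finally show ?thesis
    by (simp add: m_def)
qed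


section \<open>Local parametrizations of the unit normal bundle\<close>

text \<open>For unit vectors \<open>S \<noteq> -T\<close>, on the plane orthogonal to \<open>S\<close> this is the rotation along the
  great circle from \<open>S\<close> to \<open>T\<close>. It depends rationally on \<open>T\<close>, so it turns a frame normal to \<open>\<gamma>\<close> at
  one point into a smooth normal frame nearby.\<close>

definition tilt :: "real^3 \<Rightarrow> real^3 \<Rightarrow> real^3 \<Rightarrow> real^3" where
  "tilt S T x = x + (inverse (1 + S \<bullet> T) * (- x \<bullet> T)) *\<^sub>R (S + T)"

lemma tilt:
  assumes "norm S = 1" "norm T = 1" "1 + S \<bullet> T \<noteq> 0" "x \<bullet> S = 0"
  shows "tilt S T x \<bullet> T = 0" and "y \<bullet> S = 0 \<Longrightarrow> tilt S T x \<bullet> tilt S T y = x \<bullet> y"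
proof -
  define e where "e = inverse (1 + S \<bullet> T)"
  have e: "e * (1 + S \<bullet> T) = 1"
    using assms by (simp add: e_def)
  have ip: "S \<bullet> S = 1" "T \<bullet> T = 1"
    using assms by (simp_all add: norm_eq_1)
  \<comment> \<open>Both claims are polynomial identities modulo
    \<open>e * (1 + S \<bullet> T) = 1\<close>; each right-hand side isolates the factor that
    vanishes.\<close>
  have "tilt S T x \<bullet> T = (x \<bullet> T) * (1 - e * (1 + S \<bullet> T))"
    by (simp add: tilt_def e_def[symmetric] ip algebra_simps)
  then show "tilt S T x \<bullet> T = 0"
    unfolding e by simp
  assume y: "y \<bullet> S = 0"
  have "tilt S T x \<bullet> tilt S T y
      = x \<bullet> y + 2 * e * (x \<bullet> T) * (y \<bullet> T) * (e * (1 + S \<bullet> T) - 1)"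
    using y assms(4)
    by (simp add: tilt_def e_def[symmetric] ip inner_commute algebra_simps)
  then show "tilt S T x \<bullet> tilt S T y = x \<bullet> y"
    unfolding e by simp
qed

text \<open>Supplies the existence half of the definite description. Tilting the frame
  \<open>v\<close>, \<open>w\<close> along the curve gives an orthonormal normal frame
  \<open>V\<close>, \<open>W\<close>; the parameters are arc length and the angle in this frame,
  with \<open>v\<close> at angle 0 over \<open>s\<close>.\<close>

lemma local_parametrization_unit_normal_bundle:
  assumes reg: "regular_tubular_surface a b \<gamma> r" and sv: "(s, v) \<in> unit_normal_bundle a b \<gamma>"
  obtains U \<phi> p where "local_parametrization (unit_normal_bundle a b \<gamma>) U \<phi>" "p \<in> U" "\<phi> p = (s, v)"
proof -
  define T where "T = velocity \<gamma>"
  define S where "S = T s"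
  define w where "w = cross3 v S"
  \<comment> \<open>The parameters at which \<open>T t\<close> is not \<open>-S\<close>, so that
    \<open>tilt\<close> behaves as a rotation; \<open>s\<close> is among them because
    \<open>S \<bullet> S = 1\<close>.\<close>
  define J where "J = einterval a b \<inter> (\<lambda>t. 1 + S \<bullet> T t) -` (- {0})"
  define V where "V = (\<lambda>t. tilt S (T t) v)"
  define W where "W = (\<lambda>t. tilt S (T t) w)"
  define n where "n = (\<lambda>y::real^2. cos (y$2) *\<^sub>R V (y$1) + sin (y$2) *\<^sub>R W (y$1))"
  define \<phi> where "\<phi> = (\<lambda>y::real^2. (y$1, n y))"
  define U where "U = (\<lambda>y::real^2. y$1) -` J"
  have \<gamma>: "smooth_on (einterval a b) \<gamma>" and unit: "\<And>t. t \<in> einterval a b \<Longrightarrow> norm (T t) = 1"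
    using reg by (auto simp: regular_tubular_surface_def tubular_surface_def T_def)
  have s: "s \<in> einterval a b" and v: "norm v = 1" "v \<bullet> S = 0"
    using sv by (auto simp: unit_normal_bundle_def S_def T_def)
  have S: "norm S = 1"
    using unit[OF s] by (simp add: S_def)
  have w: "norm w = 1" "w \<bullet> S = 0" "v \<bullet> w = 0"
    using cross3_frame[OF S v] by (simp_all add: w_def dot_cross_self)
  have T_smooth: "smooth_on (einterval a b) T"
    unfolding T_def by (rule smooth_on_velocity[OF open_einterval \<gamma>])
  have "isCont T t" if "t \<in> einterval a b" for t
    using smooth_on_differentiable[OF T_smooth that] differentiable_imp_continuous_within by blast
  then have "continuous_on (einterval a b) T"
    by (simp add: continuous_at_imp_continuous_on)
  then have J: "open J"
    unfolding J_def
    by (intro continuous_open_preimage continuous_intros) (auto simp: open_Compl)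
  have U: "open U"
    unfolding U_def by (intro open_vimage J continuous_intros)
  have T_smooth: "smooth_on J T"
    by (rule smooth_on_subset[OF T_smooth]) (auto simp: J_def)
  have tilt_smooth: "smooth_on J (\<lambda>t. tilt S (T t) x)" for x
  proof -
    have *: "smooth_on J (\<lambda>t. inverse (1 + S \<bullet> T t))"
      by (rule smooth_on_inverse[OF J smooth_on_add[OF J smooth_on_const[OF J]
            smooth_on_bilinear[OF J bounded_bilinear_inner smooth_on_const[OF J] T_smooth]]])
        (auto simp: J_def)
    show ?thesis
      unfolding tilt_def
      by (rule smooth_on_add[OF J] smooth_on_bilinear[OF J bounded_bilinear_scaleR]
          smooth_on_bilinear[OF J bounded_bilinear_mult] smooth_on_bilinear[OF J bounded_bilinear_inner]
          smooth_on_const[OF J] T_smooth *)+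
  qed
  have coord: "smooth_on U (\<lambda>y. y$i)" for i
    by (rule smooth_on_bounded_linear[OF U bounded_linear_vec_nth])
  have VW_smooth: "smooth_on U (\<lambda>y. V (y$1))" "smooth_on U (\<lambda>y. W (y$1))"
    unfolding V_def W_def
    by (rule smooth_on_compose_real[OF U tilt_smooth coord]; auto simp: U_def)+
  have trig: "smooth_on U (\<lambda>y. cos (y$2))" "smooth_on U (\<lambda>y. sin (y$2))"
    by (rule smooth_on_compose_real[OF U smooth_on_sin_cos(2) coord]
        smooth_on_compose_real[OF U smooth_on_sin_cos(1) coord]; simp)+
  have n_smooth: "smooth_on U n"
    unfolding n_def
    by (rule smooth_on_add[OF U] smooth_on_bilinear[OF U bounded_bilinear_scaleR] VW_smooth trig)+
  have VW: "V t \<bullet> T t = 0" "W t \<bullet> T t = 0" "V t \<bullet> V t = 1" "W t \<bullet> W t = 1" "V t \<bullet> W t = 0" "W t \<bullet> V t = 0"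
    if "t \<in> J" for t
  proof -
    have t: "norm (T t) = 1" "1 + S \<bullet> T t \<noteq> 0"
      using that unit by (auto simp: J_def)
    have "v \<bullet> v = 1" "w \<bullet> w = 1"
      using v w by (simp_all add: norm_eq_1)
    then show "V t \<bullet> T t = 0" "W t \<bullet> T t = 0" "V t \<bullet> V t = 1" "W t \<bullet> W t = 1" "V t \<bullet> W t = 0" "W t \<bullet> V t = 0"
      using tilt[OF S t v(2)] tilt[OF S t w(2)] v w
      by (simp_all add: V_def W_def inner_commute)
  qed
  have "\<phi> y \<in> unit_normal_bundle a b \<gamma>" if "y \<in> U" for y
  proof -
    have y: "y$1 \<in> J"
      using that by (simp add: U_def)
    have "n y \<bullet> n y = cos (y$2) * cos (y$2) + sin (y$2) * sin (y$2)"
      by (simp add: n_def inner_add_left inner_add_right VW[OF y])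
    also have "\<dots> = 1"
      by (rule sin_cos_squared_add3)
    finally have "norm (n y) = 1"
      by (simp add: norm_eq_1)
    moreover have "n y \<bullet> T (y$1) = 0"
      by (simp add: n_def inner_add_left VW[OF y])
    ultimately show ?thesis
      using y by (simp add: \<phi>_def unit_normal_bundle_def T_def J_def)
  qed
  moreover have \<phi>_smooth: "smooth_on U \<phi>"
    unfolding \<phi>_def by (rule smooth_on_Pair[OF U coord n_smooth])
  \<comment> \<open>The first component of the differential is \<open>h$1\<close>, so a kernel
    vector points in the angular direction; there \<open>n\<close> runs along a unit circle with
    speed 1.\<close>
  moreover have "inj (frechet_derivative \<phi> (at y))" if "y \<in> U" for y
  proof -
    have y: "y$1 \<in> J"
      using that by (simp add: U_def)
    have dcoord: "((\<lambda>y. y$i) has_derivative (\<lambda>h. h$i)) (at y)" for i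
      by (rule bounded_linear_imp_has_derivative[OF bounded_linear_vec_nth])
    have d1: "((\<lambda>y. tilt S (T (y$1)) x) has_derivative
        (\<lambda>h. h$1 *\<^sub>R velocity (\<lambda>t. tilt S (T t) x) (y$1))) (at y)" for x
      using has_derivative_compose_velocity[of "\<lambda>t. tilt S (T t) x" "\<lambda>y. y$1",
          OF smooth_on_differentiable[OF tilt_smooth y] smooth_on_differentiable[OF coord that]]
      by (simp add: dir_deriv_eqI[OF dcoord])
    have dn: "partial_deriv 2 n y = - sin (y$2) *\<^sub>R V (y$1) + cos (y$2) *\<^sub>R W (y$1)"
    proof -
      have "(n has_derivative (\<lambda>h.
        (cos (y$2) *\<^sub>R h$1 *\<^sub>R velocity V (y$1) + (h$2 * - sin (y$2)) *\<^sub>R V (y$1)) +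
        (sin (y$2) *\<^sub>R h$1 *\<^sub>R velocity W (y$1) + (h$2 * cos (y$2)) *\<^sub>R W (y$1)))) (at y)"
        unfolding n_def V_def W_def
        by (intro has_derivative_add has_derivative_scaleR has_derivative_sin has_derivative_cos
          d1 dcoord)
      from dir_deriv_eqI[OF this, of "axis 2 1"] show ?thesis
        by (simp add: axis_def)
    qed
    have "partial_deriv 2 n y \<bullet> partial_deriv 2 n y = cos (y$2) * cos (y$2) + sin (y$2) * sin (y$2)"
      unfolding dn by (simp add: inner_add_left inner_add_right inner_diff_left inner_diff_right VW[OF y])
    also have "\<dots> = 1"
      by (rule sin_cos_squared_add3)
    finally have dn_nz: "partial_deriv 2 n y \<noteq> 0"
      by auto
    note n_diff = smooth_on_differentiable[OF n_smooth that]
    have "(\<phi> has_derivative (\<lambda>h. (h$1, dir_deriv h n y))) (at y)"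
      unfolding \<phi>_def by (rule has_derivative_Pair[OF dcoord has_derivative_dir_deriv[OF n_diff]])
    then have *: "frechet_derivative \<phi> (at y) = (\<lambda>h. (h$1, dir_deriv h n y))"
      by (rule frechet_derivative_at[symmetric])
    have "linear (frechet_derivative \<phi> (at y))"
      by (rule linear_frechet_derivative[OF smooth_on_differentiable[OF \<phi>_smooth that]])
    moreover have "h = 0" if "frechet_derivative \<phi> (at y) h = 0" for h
    proof -
      have h: "h$1 = 0" "dir_deriv h n y = 0"
        using that by (simp_all add: * zero_prod_def)
      then have "h$2 *\<^sub>R partial_deriv 2 n y = 0"
        using dir_deriv_2[OF n_diff, of h] by simp
      then have "h$2 = 0"
        using dn_nz by simp
      then show "h = 0"
        using h(1) by (simp add: vec_eq_iff forall_2)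
    qed
    ultimately show ?thesis
      by (simp add: linear_injective_0)
  qed
  ultimately have "local_parametrization (unit_normal_bundle a b \<gamma>) U \<phi>"
    using U by (auto simp: local_parametrization_def)
  moreover have "S \<bullet> S = 1"
    using S by (simp add: norm_eq_1)
  then have "s \<in> J"
    using s by (simp add: J_def S_def)
  then have "vector [s, 0] \<in> U"
    by (simp add: U_def)
  moreover have "\<phi> (vector [s, 0]) = (s, v)"
    using v by (simp add: \<phi>_def n_def V_def tilt_def S_def)
  ultimately show thesis
    by (rule that)
qed


section \<open>Tubes of constant second fundamental form\<close>

text \<open>The definite description is resolved: some parametrization passes through
  \<open>(s, v)\<close>, and all of them yield the same value.\<close>

lemma tube_second_ff_length_eq:
  assumes reg: "regular_tubular_surface a b \<gamma> r" and sv: "(s, v) \<in> unit_normal_bundle a b \<gamma>"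
  defines "k \<equiv> velocity (velocity \<gamma>) s \<bullet> v"
  shows "tube_second_ff_length a b \<gamma> r (s, v) = sqrt ((1 / r)\<^sup>2 + (k / (1 - r * k))\<^sup>2)"
  unfolding tube_second_ff_length_def second_ff_length_def
proof (rule the_equality)
  obtain U \<phi> p where *: "local_parametrization (unit_normal_bundle a b \<gamma>) U \<phi>" "p \<in> U" "\<phi> p = (s, v)"
    by (rule local_parametrization_unit_normal_bundle[OF reg sv])
  show "\<exists>U \<phi> p. local_parametrization (unit_normal_bundle a b \<gamma>) U \<phi> \<and> p \<in> U \<and> \<phi> p = (s, v) \<and>
      sqrt ((1 / r)\<^sup>2 + (k / (1 - r * k))\<^sup>2) =
      sqrt (4 * (mean_curvature (tube_map \<gamma> r \<circ> \<phi>) p)\<^sup>2 - 2 * gaussian_curvature (tube_map \<gamma> r \<circ> \<phi>) p)"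
    using * curvature_tube_local_parametrization[OF reg *] unfolding k_def by metis
next
  fix l
  assume "\<exists>U \<phi> p. local_parametrization (unit_normal_bundle a b \<gamma>) U \<phi> \<and> p \<in> U \<and> \<phi> p = (s, v) \<and>
      l = sqrt (4 * (mean_curvature (tube_map \<gamma> r \<circ> \<phi>) p)\<^sup>2 - 2 * gaussian_curvature (tube_map \<gamma> r \<circ> \<phi>) p)"
  then show "l = sqrt ((1 / r)\<^sup>2 + (k / (1 - r * k))\<^sup>2)"
    using curvature_tube_local_parametrization[OF reg] unfolding k_def by metis
qed

lemma right_cylinder_second_ff_length:
  assumes "right_cylinder a b \<gamma> r" "q \<in> unit_normal_bundle a b \<gamma>"
  shows "tube_second_ff_length a b \<gamma> r q = 1 / r"
proof -
  obtain s v where q: "q = (s, v)"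
    by (cases q)
  have reg: "regular_tubular_surface a b \<gamma> r"
    using assms by (simp add: right_cylinder_def)
  then have "r > 0"
    by (simp add: regular_tubular_surface_def tubular_surface_def)
  moreover have "velocity (velocity \<gamma>) s = 0"
    using assms by (simp add: q right_cylinder_def curve_curvature_def unit_normal_bundle_def)
  ultimately show ?thesis
    using tube_second_ff_length_eq[OF reg, of s v] assms(2) by (simp add: q)
qed

text \<open>Provides a point at which a prescribed length \<open>c\<close> can be compared with
  \<open>1 / r\<close>.\<close>

lemma unit_normal_bundle_nonempty:
  assumes "regular_tubular_surface a b \<gamma> r"
  shows "unit_normal_bundle a b \<gamma> \<noteq> {}"
proof -
  have "a < b"
    using assms by (simp add: regular_tubular_surface_def tubular_surface_def)
  then obtain s where s: "s \<in> einterval a b"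
    using einterval_nonempty by blast
  obtain v where v: "v \<noteq> 0" "orthogonal (velocity \<gamma> s) v"
    using orthogonal_to_vector_exists[of "velocity \<gamma> s"] by auto
  then have "(s, sgn v) \<in> unit_normal_bundle a b \<gamma>"
    using s by (simp add: unit_normal_bundle_def norm_sgn orthogonal_def sgn_div_norm inner_commute)
  then show ?thesis
    by blast
qed

lemma constant_second_ff_length_imp_right_cylinder:
  assumes reg: "regular_tubular_surface a b \<gamma> r"
    and const: "tube_second_ff_length a b \<gamma> r constant_on unit_normal_bundle a b \<gamma>"
  shows "right_cylinder a b \<gamma> r"
  unfolding right_cylinder_def
proof (intro conjI reg ballI)
  fix s
  assume s: "s \<in> einterval a b"
  define T where "T = velocity \<gamma>"
  define A where "A = velocity T s"
  have \<gamma>: "smooth_on (einterval a b) \<gamma>" and unit: "\<And>t. t \<in> einterval a b \<Longrightarrow> norm (T t) = 1"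
    using reg by (auto simp: regular_tubular_surface_def tubular_surface_def T_def)
  have T: "T differentiable at s"
    unfolding T_def by (rule smooth_on_differentiable[OF smooth_on_velocity[OF open_einterval \<gamma>] s])
  have "T t \<bullet> T t = 1" if "t \<in> einterval a b" for t
    using unit[OF that] by (simp add: norm_eq_1)
  \<comment> \<open>The velocity has unit length, so the acceleration is normal to the curve and its
    direction belongs to the circle over \<open>s\<close>.\<close>
  then have AT: "A \<bullet> T s = 0"
    using dir_deriv_inner_constant[OF open_einterval s _ T T, of 1 1]
    by (simp add: A_def velocity_eq_dir_deriv[OF T] inner_commute)
  show "curve_curvature \<gamma> s = 0"
  proof (rule ccontr)
    assume "curve_curvature \<gamma> s \<noteq> 0"
    then have A: "A \<noteq> 0"
      by (simp add: curve_curvature_def A_def T_def)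
    \<comment> \<open>Two points of the circle over \<open>s\<close> are compared: along
      \<open>n\<close> the component of \<open>A\<close> is 0, along \<open>A\<close> it is
      \<open>norm A\<close>.\<close>
    define n where "n = cross3 (T s) A"
    have "(norm n)\<^sup>2 = (norm A)\<^sup>2"
      using norm_cross[of "T s" A] AT unit[OF s] by (simp add: n_def inner_commute)
    then have "n \<noteq> 0"
      using A by auto
    moreover have "n \<bullet> T s = 0" "A \<bullet> n = 0"
      by (simp_all add: n_def dot_cross_self)
    ultimately have mem: "(s, sgn n) \<in> unit_normal_bundle a b \<gamma>" "(s, sgn A) \<in> unit_normal_bundle a b \<gamma>"
      using s A AT by (auto simp: unit_normal_bundle_def norm_sgn sgn_div_norm T_def)
    have k: "A \<bullet> sgn n = 0" "A \<bullet> sgn A = norm A"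
      using \<open>A \<bullet> n = 0\<close> A by (simp_all add: sgn_div_norm dot_square_norm power2_eq_square)
    have "tube_second_ff_length a b \<gamma> r (s, sgn n) = tube_second_ff_length a b \<gamma> r (s, sgn A)"
      using const mem by (auto simp: constant_on_def)
    then have "sqrt ((1 / r)\<^sup>2 + 0) = sqrt ((1 / r)\<^sup>2 + (norm A / (1 - r * norm A))\<^sup>2)"
      using tube_second_ff_length_eq[OF reg mem(1)] tube_second_ff_length_eq[OF reg mem(2)]
      by (simp add: k A_def[symmetric] T_def[symmetric])
    then have "(norm A / (1 - r * norm A))\<^sup>2 = 0"
      unfolding real_sqrt_eq_iff by simp
    \<comment> \<open>Since division by zero yields 0, the vanishing quotient gives
      \<open>A = 0\<close> only once the denominator is known to be nonzero.\<close>
    moreover have "r * norm A < 1"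
      using regular_tube_curvature_less[OF reg mem(2)] by (simp add: k A_def[symmetric] T_def[symmetric])
    ultimately show False
      using A by simp
  qed
qed

theorem corollary7:
  "(\<forall>(a::ereal) (b::ereal) (\<gamma>::real \<Rightarrow> real^3) (r::real).
      regular_tubular_surface a b \<gamma> r \<and>
      tube_second_ff_length a b \<gamma> r constant_on unit_normal_bundle a b \<gamma>
      \<longleftrightarrow> right_cylinder a b \<gamma> r) \<and>
   (\<forall>c::real. c > 0 \<longrightarrow>
     (\<forall>(a::ereal) (b::ereal) (\<gamma>::real \<Rightarrow> real^3) (r::real).
        regular_tubular_surface a b \<gamma> r \<and>
        (\<forall>q\<in>unit_normal_bundle a b \<gamma>. tube_second_ff_length a b \<gamma> r q = c)
        \<longleftrightarrow> right_cylinder a b \<gamma> r \<and> r = 1 / c))"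
proof (intro conjI allI impI)
  fix a b :: ereal and \<gamma> :: "real \<Rightarrow> real^3" and r :: real
  show cyl: "regular_tubular_surface a b \<gamma> r \<and>
      tube_second_ff_length a b \<gamma> r constant_on unit_normal_bundle a b \<gamma>
      \<longleftrightarrow> right_cylinder a b \<gamma> r"
    using constant_second_ff_length_imp_right_cylinder right_cylinder_second_ff_length
    unfolding constant_on_def by (metis right_cylinder_def)
  fix c :: real
  assume c: "c > 0"
  show "regular_tubular_surface a b \<gamma> r \<and>
      (\<forall>q\<in>unit_normal_bundle a b \<gamma>. tube_second_ff_length a b \<gamma> r q = c)
      \<longleftrightarrow> right_cylinder a b \<gamma> r \<and> r = 1 / c"
  proof
    assume L: "regular_tubular_surface a b \<gamma> r \<and>
      (\<forall>q\<in>unit_normal_bundle a b \<gamma>. tube_second_ff_length a b \<gamma> r q = c)"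
    \<comment> \<open>Length \<open>c\<close> everywhere is a case of constancy, so the first part
      gives a cylinder; evaluating at one point then fixes the radius.\<close>
    then have rc: "right_cylinder a b \<gamma> r"
      using cyl unfolding constant_on_def by blast
    moreover obtain q where "q \<in> unit_normal_bundle a b \<gamma>"
      using unit_normal_bundle_nonempty L by blast
    ultimately have "c = 1 / r"
      using right_cylinder_second_ff_length L by metis
    then show "right_cylinder a b \<gamma> r \<and> r = 1 / c"
      using rc by simp
  next
    assume "right_cylinder a b \<gamma> r \<and> r = 1 / c"
    then show "regular_tubular_surface a b \<gamma> r \<and>
      (\<forall>q\<in>unit_normal_bundle a b \<gamma>. tube_second_ff_length a b \<gamma> r q = c)"
      using right_cylinder_second_ff_length[of a b \<gamma> r] by (auto simp: right_cylinder_def)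
  qed
qed

end
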